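(* Let $m,n\ge 1$ and let $\boldsymbol{\xi}\in\mathbb{R}^{n\times m}$ be totally irrational. Let $\|\cdot\|_1$ be an arbitrary norm on $\mathbb{R}^m$ and $\|\cdot\|_2$ an arbitrary norm on $\mathbb{R}^n$. Let $(X_i)_{i\ge1},(L_i)_{i\ge1}$ be the sequences of best approximation norms and remainders of $\boldsymbol{\xi}$ with respect to the sup-norms on $\mathbb{R}^m$ and $\mathbb{R}^n$, and let $(X_i')_{i\ge1},(L_i')_{i\ge1}$ be the corresponding sequences with respect to the pair of norms $\|\cdot\|_1,\|\cdot\|_2$. Then: (1) $\sup_i X_{i+1}/X_i<\infty$ if and only if $\sup_i X'_{i+1}/X'_i<\infty$; (2) $\sup_i L_i/L_{i+1}<\infty$ if and only if $\sup_i L'_i/L'_{i+1}<\infty$.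
   Context: For $\mathbf{x}=(\boldsymbol{x},\boldsymbol{y})\in\mathbb{Z}^{m+n}$ with $\boldsymbol{x}\in\mathbb{Z}^m$, $\boldsymbol{y}\in\mathbb{Z}^n$, write $L_{\boldsymbol{\xi}}(\mathbf{x})=\|\boldsymbol{\xi}\boldsymbol{x}-\boldsymbol{y}\|$. The matrix $\boldsymbol{\xi}$ is totally irrational if $L_{\boldsymbol{\xi}}(\mathbf{x})>0$ for every nonzero $\mathbf{x}\in\mathbb{Z}^{m+n}$. Given norms $N_1$ on $\mathbb{R}^m$ and $N_2$ on $\mathbb{R}^n$, consider the nonincreasing step function $X\mapsto \min\{N_2(\boldsymbol{\xi}\boldsymbol{x}-\boldsymbol{y}) : (\boldsymbol{x},\boldsymbol{y})\in\mathbb{Z}^{m+n},\ 0<N_1(\boldsymbol{x})\le X\}$; its successive jump points (values of $N_1(\boldsymbol{x})$ of best approximation vectors) form the strictly increasing sequence $X_1<X_2<\cdots$ and its successive values form the strictly decreasing sequence $L_1>L_2>\cdots$ (so $L_i$ is the value on $[X_i,X_{i+1})$). For totally irrational $\boldsymbol{\xi}$ these sequences are infinite and uniquely defined. With $N_1,N_2$ the sup-norms one obtains $X_i,L_i$; with $N_1=\|\cdot\|_1,N_2=\|\cdot\|_2$ one obtains $X'_i,L'_i$. *)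

theory Defs
  imports "HOL-Analysis.Analysis"
begin

definition is_norm :: "('a::real_vector \<Rightarrow> real) \<Rightarrow> bool" where
  "is_norm N \<longleftrightarrow>
     (\<forall>v. 0 \<le> N v) \<and>
     (\<forall>v. N v = 0 \<longleftrightarrow> v = 0) \<and>
     (\<forall>c v. N (c *\<^sub>R v) = \<bar>c\<bar> * N v) \<and>
     (\<forall>v w. N (v + w) \<le> N v + N w)"

definition integer_vectors :: "(real ^ 'k) set" where
  "integer_vectors = {v. \<forall>i. v $ i \<in> \<int>}"

definition totally_irrational :: "real ^ 'm ^ 'n \<Rightarrow> bool" where
  "totally_irrational \<xi> \<longleftrightarrow>
     (\<forall>x \<in> integer_vectors. \<forall>y \<in> integer_vectors.
        (x, y) \<noteq> (0, 0) \<longrightarrow> infnorm (\<xi> *v x - y) > 0)"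

(* The step function X \<mapsto> min N2 (\<xi> x - y) over integer x, y with 0 < N1 x \<le> X. For norms
   N1, N2 the infimum is a minimum whenever some integer x satisfies 0 < N1 x \<le> X: only
   finitely many x are admissible, and \<xi> x - y ranges over a translate of a lattice. *)
definition min_remainder ::
    "(real ^ 'm \<Rightarrow> real) \<Rightarrow> (real ^ 'n \<Rightarrow> real) \<Rightarrow> real ^ 'm ^ 'n \<Rightarrow> real \<Rightarrow> real" where
  "min_remainder N1 N2 \<xi> X =
     Inf {N2 (\<xi> *v x - y) | x y.
            x \<in> integer_vectors \<and> y \<in> integer_vectors \<and> 0 < N1 x \<and> N1 x \<le> X}"

(* Successive jump points of the step function. The first is the least X at which its domain
   of minimisation is nonempty; below it the function is undefined, hence the guard
   best_norm N1 N2 \<xi> i < X in the recursion. Both infima are attained, as the jumps lie in the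
   discrete set of values of N1 at integer vectors. Indices are shifted by one: best_norm i
   and best_remainder i are the (i+1)-st terms of the sequences numbered from 1. *)
primrec best_norm ::
    "(real ^ 'm \<Rightarrow> real) \<Rightarrow> (real ^ 'n \<Rightarrow> real) \<Rightarrow> real ^ 'm ^ 'n \<Rightarrow> nat \<Rightarrow> real" where
  "best_norm N1 N2 \<xi> 0 = Inf {N1 x | x. x \<in> integer_vectors \<and> 0 < N1 x}"
| "best_norm N1 N2 \<xi> (Suc i) =
     Inf {X. best_norm N1 N2 \<xi> i < X \<and>
             min_remainder N1 N2 \<xi> X < min_remainder N1 N2 \<xi> (best_norm N1 N2 \<xi> i)}"

definition best_remainder ::
    "(real ^ 'm \<Rightarrow> real) \<Rightarrow> (real ^ 'n \<Rightarrow> real) \<Rightarrow> real ^ 'm ^ 'n \<Rightarrow> nat \<Rightarrow> real" where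
  "best_remainder N1 N2 \<xi> i = min_remainder N1 N2 \<xi> (best_norm N1 N2 \<xi> i)"

end

(* Boundedness of X_{i+1}/X_i says that from every approximation vector of small remainder one
   reaches a strictly smaller remainder at bounded relative cost in the norm of x; boundedness of
   L_i/L_{i+1} is the same statement with the roles of norm and remainder exchanged. Iterating the
   step K times and taking the difference of two vectors whose decreasing coordinates are close
   (pigeonhole) turns "strictly smaller" into "smaller by any prescribed factor", still at bounded
   cost, and this stronger property does not depend on the choice of equivalent norms. *)
theory Submission
  imports Defs
begin

section \<open>Norms on Euclidean spaces\<close>

text \<open>The obstacle is that "strictly smaller" does not survive a change of norms: passing to
  equivalent norms and back costs a factor \<open>k\<^sup>2\<close>, while the hypothesis does not
  exclude that successive values are nearly equal. A definite gain comes only from the group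
  structure. In a difference of two vectors the decreasing coordinate is small by compactness, and
  the other one is at most twice the larger of the two. The danger is a difference with
  \<open>x = 0\<close>. The zero vector is excluded because the coordinate decreases strictly along
  the iteration; a difference \<open>(0, y)\<close> with \<open>y \<noteq> 0\<close> is excluded
  because its remainder is bounded below. For this reason only vectors of small remainder are
  considered, which is harmless for a ratio that need only be bounded from some index on. In the
  second equivalence the restriction has another purpose as well: from a vector of least norm no
  descent in the norm is possible.\<close>

lemma is_norm_infnorm: "is_norm (infnorm :: 'a::euclidean_space \<Rightarrow> real)"
  by (auto simp: is_norm_def infnorm_pos_le infnorm_eq_0 infnorm_mul infnorm_triangle)

lemma is_norm_diff_le:
  assumes "is_norm N"
  shows "N (v - w) \<le> N v + N w"
proof -
  have "N (v + (-1) *\<^sub>R w) \<le> N v + N ((-1) *\<^sub>R w)"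
    using assms unfolding is_norm_def by blast
  moreover have "N ((-1) *\<^sub>R w) = \<bar>-1\<bar> * N w"
    using assms unfolding is_norm_def by blast
  ultimately show ?thesis by simp
qed

lemma is_norm_sum_le:
  assumes "is_norm N" "finite I"
  shows "N (sum f I) \<le> (\<Sum>i\<in>I. N (f i))"
  using assms(2)
proof (induction I rule: finite_induct)
  case empty
  have "N 0 = 0" using assms(1) unfolding is_norm_def by blast
  then show ?case by simp
next
  case (insert i I)
  have "N (f i + sum f I) \<le> N (f i) + N (sum f I)"
    using assms(1) unfolding is_norm_def by blast
  then show ?case using insert by simp
qed

lemma is_norm_le_norm:
  fixes N :: "'a::euclidean_space \<Rightarrow> real"
  assumes "is_norm N"
  obtains b where "b > 0" "\<And>v. N v \<le> b * norm v"
proof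
  define b where "b = (\<Sum>i\<in>Basis. N (i::'a))"
  have nonneg: "0 \<le> N v" for v using assms by (auto simp: is_norm_def)
  have scale: "N (c *\<^sub>R v) = \<bar>c\<bar> * N v" for c v using assms by (auto simp: is_norm_def)
  have "b \<ge> 0" unfolding b_def by (intro sum_nonneg nonneg)
  then show "b + 1 > 0" by simp
  fix v :: 'a
  have "N v = N (\<Sum>i\<in>Basis. (v \<bullet> i) *\<^sub>R i)" by (simp add: euclidean_representation)
  also have "\<dots> \<le> (\<Sum>i\<in>Basis. N ((v \<bullet> i) *\<^sub>R i))" by (rule is_norm_sum_le[OF assms]) simp
  also have "\<dots> \<le> (\<Sum>i\<in>Basis. norm v * N i)"
    unfolding scale by (intro sum_mono mult_right_mono nonneg Basis_le_norm)
  also have "\<dots> = b * norm v" by (simp add: b_def sum_distrib_left mult.commute)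
  also have "\<dots> \<le> (b + 1) * norm v" by (simp add: mult_right_mono)
  finally show "N v \<le> (b + 1) * norm v" .
qed

text \<open>Compactness: the opposite estimate makes \<open>N\<close> Lipschitz, so \<open>N\<close>
  attains a positive minimum on the unit sphere, and homogeneity does the rest.\<close>

lemma norm_le_is_norm:
  fixes N :: "'a::euclidean_space \<Rightarrow> real"
  assumes N: "is_norm N"
  obtains a where "a > 0" "\<And>v. norm v \<le> a * N v"
proof -
  have scale: "N (c *\<^sub>R v) = \<bar>c\<bar> * N v" for c v using assms by (auto simp: is_norm_def)
  have pos: "0 < N v" if "v \<noteq> 0" for v
    using assms that unfolding is_norm_def by (metis order_less_le)
  obtain b where b: "b > 0" "\<And>v. N v \<le> b * norm v" using is_norm_le_norm[OF N] by blast
  have "\<bar>N v - N w\<bar> \<le> b * norm (v - w)" for v w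
  proof -
    have "N v \<le> N (v - w) + N w" "N w \<le> N (w - v) + N v"
      using N unfolding is_norm_def by (metis diff_add_cancel)+
    then show ?thesis using b(2)[of "v - w"] b(2)[of "w - v"] by (simp add: norm_minus_commute)
  qed
  then have "b-lipschitz_on (sphere 0 1) N"
    using b(1) by (intro lipschitz_onI) (auto simp: dist_norm)
  then have "continuous_on (sphere 0 1) N" by (rule lipschitz_on_continuous_on)
  moreover obtain u0 :: 'a where "norm u0 = 1" using vector_choose_size[of 1] by auto
  then have "sphere (0::'a) 1 \<noteq> {}" by auto
  ultimately obtain u where u: "norm u = 1" "\<And>v. norm v = 1 \<Longrightarrow> N u \<le> N v"
    using continuous_attains_inf[OF compact_sphere, of 0 1 N] by auto
  have "u \<noteq> 0" using u(1) by auto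
  then have Nu: "N u > 0" by (rule pos)
  have "norm v \<le> (1 / N u) * N v" for v
  proof (cases "v = 0")
    case False
    then have "N u \<le> N ((1 / norm v) *\<^sub>R v)" by (intro u(2)) simp
    then show ?thesis using False Nu by (simp add: scale field_simps)
  next
    case True
    then show ?thesis using N Nu by (simp add: is_norm_def)
  qed
  then show ?thesis using that[of "1 / N u"] Nu by simp
qed

lemma is_norm_equivalent:
  fixes N N' :: "'a::euclidean_space \<Rightarrow> real"
  assumes "is_norm N" "is_norm N'"
  obtains k where "k > 0" "\<And>v. N v \<le> k * N' v"
proof -
  obtain a where a: "a > 0" "\<And>v. norm v \<le> a * N' v" using norm_le_is_norm[OF assms(2)] by blast
  obtain b where b: "b > 0" "\<And>v. N v \<le> b * norm v" using is_norm_le_norm[OF assms(1)] by blast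
  have "N v \<le> (b * a) * N' v" for v
  proof -
    have "b * norm v \<le> b * (a * N' v)" using a b by (intro mult_left_mono) auto
    then show ?thesis using b(2)[of v] by simp
  qed
  then show ?thesis using that[of "b * a"] a b by simp
qed

text \<open>Scaling by \<open>1 / s\<close> moves all vectors into one fixed ball, so
  \<open>K\<close> depends on \<open>\<eta>\<close> only. This uniformity in \<open>s\<close> keeps
  the number of iterated descent steps, and hence their cost, bounded.\<close>

lemma is_norm_pigeonhole:
  fixes N :: "'a::euclidean_space \<Rightarrow> real"
  assumes N: "is_norm N" and "\<eta> > 0"
  obtains K :: nat where
    "\<And>s (v :: nat \<Rightarrow> 'a). s > 0 \<Longrightarrow> (\<And>j. j \<le> K \<Longrightarrow> N (v j) \<le> s) \<Longrightarrow>
      \<exists>i j. i < j \<and> j \<le> K \<and> N (v i - v j) \<le> \<eta> * s"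
proof -
  obtain a where a: "a > 0" "\<And>v. norm v \<le> a * N v" using norm_le_is_norm[OF N] by blast
  obtain b where b: "b > 0" "\<And>v. N v \<le> b * norm v" using is_norm_le_norm[OF N] by blast
  \<comment> \<open>Two vectors in the same ball of radius \<open>e\<close> are less than
    \<open>2 * e\<close> apart; the factor \<open>b\<close> converts this back to
    \<open>N\<close>.\<close>
  define e where "e = \<eta> / (2 * b)"
  have "e > 0" using b \<open>\<eta> > 0\<close> by (simp add: e_def)
  obtain k where k: "finite k" "cball (0::'a) a \<subseteq> (\<Union>x\<in>k. ball x e)"
    using compact_cball[of "0::'a" a] \<open>e > 0\<close> unfolding compact_eq_totally_bounded by blast
  show ?thesis
  proof (rule that[of "card k"])
    fix s :: real and v :: "nat \<Rightarrow> 'a"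
    assume s: "s > 0" and v: "\<And>j. j \<le> card k \<Longrightarrow> N (v j) \<le> s"
    have "\<forall>j\<in>{..card k}. \<exists>x\<in>k. dist x ((1 / s) *\<^sub>R v j) < e"
    proof
      fix j assume "j \<in> {..card k}"
      then have "norm (v j) \<le> a * s"
        using a(2)[of "v j"] v[of j] a(1) by (meson atMost_iff mult_left_mono order.trans less_imp_le)
      then have "(1 / s) *\<^sub>R v j \<in> cball 0 a" using s by (simp add: field_simps)
      then have "(1 / s) *\<^sub>R v j \<in> (\<Union>x\<in>k. ball x e)" using k(2) by blast
      then show "\<exists>x\<in>k. dist x ((1 / s) *\<^sub>R v j) < e" by (simp only: UN_iff mem_ball)
    qed
    then obtain c where c: "\<And>j. j \<le> card k \<Longrightarrow> c j \<in> k"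
      "\<And>j. j \<le> card k \<Longrightarrow> dist (c j) ((1 / s) *\<^sub>R v j) < e"
      by (metis atMost_iff)
    have "card (c ` {..card k}) \<le> card k" using c(1) k(1) by (intro card_mono) auto
    then have "\<not> inj_on c {..card k}" by (intro pigeonhole) simp
    then obtain i j where ij: "i < j" "j \<le> card k" "c i = c j"
      unfolding inj_on_def by (metis atMost_iff nat_neq_iff)
    have "dist ((1 / s) *\<^sub>R v i) ((1 / s) *\<^sub>R v j) < 2 * e"
      using dist_triangle3[of "(1 / s) *\<^sub>R v i" "(1 / s) *\<^sub>R v j" "c i"] c(2)[of i] c(2)[of j] ij
      by simp
    then have "norm (v i - v j) < 2 * e * s"
      using s by (simp add: dist_norm flip: scaleR_diff_right) (simp add: field_simps)
    then have "b * norm (v i - v j) \<le> b * (2 * e * s)" using b(1) by simp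
    also have "\<dots> = \<eta> * s" using b(1) by (simp add: e_def)
    finally show "\<exists>i j. i < j \<and> j \<le> card k \<and> N (v i - v j) \<le> \<eta> * s"
      using b(2)[of "v i - v j"] ij by force
  qed
qed

section \<open>Transfer of descent between norms\<close>

text \<open>In the application \<open>S\<close> is the remainder, and thus equals \<open>F\<close> or \<open>G\<close>. Restricting to small \<open>S\<close>
  loses only finitely many indices, and guarantees that the difference of two distinct
  approximation vectors is again one, i.e. has nonzero \<open>x\<close>.\<close>

definition descends :: "'a set \<Rightarrow> ('a \<Rightarrow> real) \<Rightarrow> ('a \<Rightarrow> real) \<Rightarrow> ('a \<Rightarrow> real) \<Rightarrow> bool" where
  "descends P F G S \<longleftrightarrow>
     (\<exists>R. \<exists>\<epsilon>>0. \<forall>p\<in>P. S p < \<epsilon> \<longrightarrow> (\<exists>q\<in>P. F q \<le> R * F p \<and> G q < G p))"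

text \<open>\<open>F\<close> may grow by a bounded factor while \<open>G\<close> must decrease; norm
  and remainder take these roles in either order. The pigeonhole principle is a hypothesis because
  \<open>G\<close> sees only one component of a point, a different one in each use.\<close>

lemma descends_transfer:
  fixes P :: "'a::ab_group_add set"
  assumes desc: "descends P F G S"
    and S: "S = F \<and> S' = F' \<or> S = G \<and> S' = G'"
    and F_nonneg: "\<And>p. 0 \<le> F p"
    and F_diff: "\<And>p q. F (p - q) \<le> F p + F q"
    and G_nonneg: "\<And>p. 0 \<le> G p"
    and pigeonhole: "\<And>\<eta>. \<eta> > 0 \<Longrightarrow> \<exists>K. \<forall>s>0. \<forall>v :: nat \<Rightarrow> 'a. (\<forall>j\<le>K. G (v j) \<le> s) \<longrightarrow>
      (\<exists>i j. i < j \<and> j \<le> K \<and> G (v i - v j) \<le> \<eta> * s)"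
    and c: "c > 0" "\<And>p q. p \<in> P \<Longrightarrow> q \<in> P \<Longrightarrow> p \<noteq> q \<Longrightarrow> S (p - q) < c \<Longrightarrow> p - q \<in> P"
    and k: "k > 0" "\<And>p. F p \<le> k * F' p" "\<And>p. F' p \<le> k * F p"
      "\<And>p. G p \<le> k * G' p" "\<And>p. G' p \<le> k * G p"
    and G'_pos: "\<And>p. p \<in> P \<Longrightarrow> 0 < G' p"
  shows "descends P F' G' S'"
proof -
  obtain R0 \<epsilon> where "\<epsilon> > 0"
    and R0: "\<And>p. p \<in> P \<Longrightarrow> S p < \<epsilon> \<Longrightarrow> \<exists>q\<in>P. F q \<le> R0 * F p \<and> G q < G p"
    using desc unfolding descends_def by blast
  \<comment> \<open>With \<open>R \<ge> 1\<close> the powers increase, so \<open>R ^ K\<close>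
    bounds the cost of every shorter iteration.\<close>
  define R where "R = max R0 1"
  have "R \<ge> 1" by (simp add: R_def)
  have "\<exists>q\<in>P. F q \<le> R * F p \<and> G q < G p" if p: "p \<in> P" "S p < \<epsilon>" for p
    using R0[OF p] mult_right_mono[OF _ F_nonneg[of p], of R0 R] unfolding R_def
    by (meson max.cobounded1 order.trans)
  then obtain f where f: "\<And>p. p \<in> P \<Longrightarrow> S p < \<epsilon> \<Longrightarrow> f p \<in> P \<and> F (f p) \<le> R * F p \<and> G (f p) < G p"
    by metis
  \<comment> \<open>Going from \<open>G'\<close> to \<open>G\<close> and back costs \<open>k\<close>
    each time; this choice still leaves \<open>G' d \<le> G' p / 2\<close>.\<close>
  define \<eta> where "\<eta> = 1 / (2 * k\<^sup>2)"
  have "\<eta> > 0" using k(1) by (simp add: \<eta>_def)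
  obtain K where K: "\<And>s (v :: nat \<Rightarrow> 'a). s > 0 \<Longrightarrow> (\<And>j. j \<le> K \<Longrightarrow> G (v j) \<le> s) \<Longrightarrow>
      \<exists>i j. i < j \<and> j \<le> K \<and> G (v i - v j) \<le> \<eta> * s"
    using pigeonhole[OF \<open>\<eta> > 0\<close>] by blast
  \<comment> \<open>One bound for the growth of \<open>S\<close> in both cases: from
    \<open>p\<close> to the difference it grows by at most \<open>2 * R ^ K\<close> if
    \<open>S = F\<close> and by at most \<open>\<eta>\<close> if \<open>S = G\<close>; the iterates
    need \<open>R ^ K\<close>.\<close>
  define M where "M = 2 * R ^ K + \<eta>"
  have RK: "R ^ K \<ge> 1" using \<open>R \<ge> 1\<close> by (rule one_le_power)
  have "M > 0" "R ^ K \<le> M" "2 * R ^ K \<le> M" "\<eta> \<le> M" using \<open>\<eta> > 0\<close> RK by (auto simp: M_def)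
  \<comment> \<open>The factor \<open>k\<close> accounts for replacing \<open>S'\<close> by
    \<open>S\<close>. Then \<open>M * S p\<close> lies below \<open>\<epsilon>\<close>, so that
    \<open>f\<close> applies to all iterates, and below \<open>c\<close>, so that the difference
    stays in \<open>P\<close>.\<close>
  define \<epsilon>' where "\<epsilon>' = min \<epsilon> c / (k * M)"
  have "\<epsilon>' > 0" using \<open>\<epsilon> > 0\<close> c(1) k(1) \<open>M > 0\<close> by (simp add: \<epsilon>'_def)
  have S_nonneg: "0 \<le> S p" for p using S F_nonneg G_nonneg by auto
  have "\<exists>q\<in>P. F' q \<le> (k * (2 * R ^ K) * k) * F' p \<and> G' q < G' p"
    if p: "p \<in> P" and small: "S' p < \<epsilon>'" for p
  proof -
    have "S p \<le> k * S' p" using S k by auto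
    also have "\<dots> < k * \<epsilon>'" using small k(1) by simp
    finally have "M * S p < M * (k * \<epsilon>')" using \<open>M > 0\<close> by simp
    also have "\<dots> = min \<epsilon> c" using k(1) \<open>M > 0\<close> by (simp add: \<epsilon>'_def)
    finally have MS: "M * S p < \<epsilon>" "M * S p < c" by auto
    define v where "v j = (f ^^ j) p" for j
    \<comment> \<open>The bounds are premises so that this can serve inside the induction that
      proves them.\<close>
    have Sv: "S (v j) < \<epsilon>" if "j \<le> K" "F (v j) \<le> R ^ j * F p" "G (v j) \<le> G p" for j
    proof -
      have Rj: "R ^ j \<le> R ^ K" using \<open>j \<le> K\<close> \<open>R \<ge> 1\<close> by (rule power_increasing)
      have R1: "1 \<le> R ^ j" using \<open>R \<ge> 1\<close> by (rule one_le_power)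
      have "S (v j) \<le> R ^ j * S p"
        using S that(2,3) mult_right_mono[OF R1 G_nonneg[of p]] by auto
      also have "\<dots> \<le> M * S p"
        using Rj \<open>R ^ K \<le> M\<close> S_nonneg by (intro mult_right_mono) auto
      finally show ?thesis using MS by simp
    qed
    have inv: "v j \<in> P \<and> F (v j) \<le> R ^ j * F p \<and> G (v j) \<le> G p" if "j \<le> K" for j
      using that
    proof (induction j)
      case 0
      then show ?case using p by (simp add: v_def)
    next
      case (Suc j)
      then have IH: "v j \<in> P" "F (v j) \<le> R ^ j * F p" "G (v j) \<le> G p" by auto
      have "v (Suc j) = f (v j)" by (simp add: v_def)
      moreover have "S (v j) < \<epsilon>" using Suc.prems IH by (intro Sv) auto
      ultimately have step: "v (Suc j) \<in> P" "F (v (Suc j)) \<le> R * F (v j)" "G (v (Suc j)) < G (v j)"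
        using f[OF IH(1)] by auto
      have "R * F (v j) \<le> R * (R ^ j * F p)"
        using IH(2) \<open>R \<ge> 1\<close> by (intro mult_left_mono) auto
      then show ?case using step IH by simp
    qed
    have dec: "G (v j) < G (v i)" if "i < j" "j \<le> K" for i j
      using that
    proof (induction j)
      case (Suc j)
      have "v (Suc j) = f (v j)" by (simp add: v_def)
      moreover have "v j \<in> P" "S (v j) < \<epsilon>" using inv[of j] Sv[of j] Suc.prems by auto
      ultimately have "G (v (Suc j)) < G (v j)" using f by auto
      then show ?case using Suc by (cases "i = j") auto
    qed simp
    have "G p > 0" using G'_pos[OF p] k(1) k(5)[of p]
      by (meson less_le_trans zero_less_mult_pos)
    then obtain i j where ij: "i < j" "j \<le> K" and Gd: "G (v i - v j) \<le> \<eta> * G p"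
      using K[of "G p" v] inv by blast
    define d where "d = v i - v j"
    have "F (v l) \<le> R ^ K * F p" if "l \<le> K" for l
      using inv[OF that] mult_right_mono[OF power_increasing[OF that \<open>R \<ge> 1\<close>] F_nonneg[of p]]
      by linarith
    from this[of i] this[of j] have Fd: "F d \<le> 2 * R ^ K * F p"
      using F_diff[of "v i" "v j"] ij unfolding d_def by simp
    have "S d \<le> M * S p"
      using S Fd Gd mult_right_mono[OF \<open>2 * R ^ K \<le> M\<close> F_nonneg[of p]]
        mult_right_mono[OF \<open>\<eta> \<le> M\<close> G_nonneg[of p]] unfolding d_def by force
    \<comment> \<open>Strict decrease of \<open>G\<close> along the iteration makes
      \<open>v i\<close> and \<open>v j\<close> distinct.\<close>
    then have "d \<in> P"
      using MS inv[of i] inv[of j] dec[OF ij] ij unfolding d_def by (intro c(2)) auto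
    moreover have "F' d \<le> (k * (2 * R ^ K) * k) * F' p"
    proof -
      have "F' d \<le> k * F d" by (rule k)
      also have "\<dots> \<le> k * (2 * R ^ K * (k * F' p))"
        using Fd k(2)[of p] k(1) RK
        by (intro mult_left_mono order.trans[OF Fd]) auto
      finally show ?thesis by (simp add: mult_ac)
    qed
    moreover have "G' d < G' p"
    proof -
      have "G' d \<le> k * G d" by (rule k)
      also have "\<dots> \<le> k * (\<eta> * (k * G' p))"
        using Gd k(4)[of p] k(1) \<open>\<eta> > 0\<close> unfolding d_def
        by (intro mult_left_mono order.trans[OF Gd]) auto
      also have "\<dots> = G' p / 2" using k(1) by (simp add: \<eta>_def power2_eq_square)
      finally show ?thesis using G'_pos[OF p] by simp
    qed
    ultimately show ?thesis by blast
  qed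
  then show ?thesis unfolding descends_def using \<open>\<epsilon>' > 0\<close> by blast
qed

section \<open>The sequence of minimal points of a planar point set\<close>

lemma bounded_tail_imp_bounded:
  fixes u :: "nat \<Rightarrow> real"
  assumes "\<And>i. n \<le> i \<Longrightarrow> u i \<le> C"
  shows "\<exists>C. \<forall>i. u i \<le> C"
proof -
  have "u i \<le> max C (Max (u ` {..n}))" for i
    using assms[of i] by (cases "n \<le> i") (auto simp: le_max_iff_disj)
  then show ?thesis by blast
qed

text \<open>\<open>A\<close> is the norm of \<open>x\<close>, \<open>B\<close> the remainder. Only
  rectangles are assumed finite, since over a single \<open>x\<close> there are infinitely many
  \<open>y\<close>. \<open>B_bounded\<close> compensates: the search for the least \<open>A\<close>
  can be confined to bounded \<open>B\<close>. \<open>B_small\<close> keeps the sequence from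
  ending.\<close>

locale staircase =
  fixes P :: "'a set" and A B :: "'a \<Rightarrow> real" and m :: "real \<Rightarrow> real" and X :: "nat \<Rightarrow> real"
  assumes A_pos: "p \<in> P \<Longrightarrow> 0 < A p"
    and B_pos: "p \<in> P \<Longrightarrow> 0 < B p"
    and finite_below: "finite {p \<in> P. A p \<le> a \<and> B p \<le> b}"
    and B_bounded: "\<exists>b. \<forall>p\<in>P. \<exists>q\<in>P. A q = A p \<and> B q \<le> b"
    and B_small: "\<epsilon> > 0 \<Longrightarrow> \<exists>p\<in>P. B p < \<epsilon>"
    and m_eq: "m t = Inf (B ` {p \<in> P. A p \<le> t})"
    and X_0: "X 0 = Inf (A ` P)"
    and X_Suc: "X (Suc i) = Inf {t. X i < t \<and> m t < m (X i)}"
begin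

text \<open>Only the competitors that are no worse than \<open>p\<close> have to lie in a rectangle.
  This serves both for minimising \<open>B\<close> under a bound on \<open>A\<close> and for the
  converse.\<close>

lemma minimal_point:
  assumes "p \<in> P" "Q p" and f: "f = A \<or> f = B"
    and bounded: "\<And>q. q \<in> P \<Longrightarrow> Q q \<Longrightarrow> f q \<le> f p \<Longrightarrow> A q \<le> a \<and> B q \<le> b"
  obtains q where "q \<in> P" "Q q" "\<And>r. r \<in> P \<Longrightarrow> Q r \<Longrightarrow> f q \<le> f r"
proof -
  define T where "T = {q \<in> P. Q q \<and> f q \<le> f p}"
  have "T \<subseteq> {q \<in> P. A q \<le> a \<and> B q \<le> b}" using bounded by (auto simp: T_def)
  then have "finite T" using finite_below finite_subset by blast
  moreover have "p \<in> T" using assms by (auto simp: T_def)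
  ultimately obtain q where q: "q \<in> T" "\<And>r. r \<in> T \<Longrightarrow> f q \<le> f r"
    using ex_min_if_finite[of "f ` T"] by (metis empty_iff finite_imageI image_iff image_is_empty not_less)
  have "f q \<le> f r" if "r \<in> P" "Q r" for r
    using q that unfolding T_def by (metis (mono_tags, lifting) linear mem_Collect_eq order.trans)
  then show ?thesis using that q by (auto simp: T_def)
qed

text \<open>The witness \<open>p\<close> guards against the infimum of the empty set, which carries
  no information.\<close>

lemma m_attained:
  assumes "p \<in> P" "A p \<le> t"
  obtains q where "q \<in> P" "A q \<le> t" "B q = m t" "\<And>r. r \<in> P \<Longrightarrow> A r \<le> t \<Longrightarrow> B q \<le> B r"
proof -
  obtain q where q: "q \<in> P" "A q \<le> t" "\<And>r. r \<in> P \<Longrightarrow> A r \<le> t \<Longrightarrow> B q \<le> B r"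
    using minimal_point[of p "\<lambda>q. A q \<le> t" B t "B p"] assms by blast
  then have "m t = B q" unfolding m_eq by (intro cInf_eq_minimum) auto
  then show ?thesis using that q by auto
qed

lemma m_le:
  assumes "p \<in> P" "A p \<le> t"
  shows "m t \<le> B p"
proof -
  obtain q where "B q = m t" "\<And>r. r \<in> P \<Longrightarrow> A r \<le> t \<Longrightarrow> B q \<le> B r"
    using m_attained[OF assms] by blast
  then show ?thesis using assms by fastforce
qed

lemma X_0_least: "(\<exists>p\<in>P. A p = X 0) \<and> (\<forall>q\<in>P. X 0 \<le> A q)"
proof -
  obtain b where b: "\<And>p. p \<in> P \<Longrightarrow> \<exists>q\<in>P. A q = A p \<and> B q \<le> b" using B_bounded by blast
  obtain p where "p \<in> P" using B_small[of 1] by auto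
  then obtain p' where p': "p' \<in> P" "B p' \<le> b" using b by blast
  obtain q where q: "q \<in> P" "B q \<le> b" "\<And>r. r \<in> P \<Longrightarrow> B r \<le> b \<Longrightarrow> A q \<le> A r"
    using minimal_point[of p' "\<lambda>q. B q \<le> b" A "A p'" b] p' by blast
  have "A q \<le> A r" if "r \<in> P" for r using b[OF that] q(3) by metis
  moreover from this have "X 0 = A q" unfolding X_0 using q(1) by (intro cInf_eq_minimum) auto
  ultimately show ?thesis using q(1) by auto
qed

text \<open>Passes from an infimum over real thresholds to a minimum over points: \<open>m\<close>
  first drops below \<open>m (X i)\<close> at the least \<open>A\<close> among the points with
  smaller \<open>B\<close>.\<close>

lemma X_Suc_least:
  assumes "p \<in> P" "A p = X i"
  shows "(\<exists>q\<in>P. A q = X (Suc i) \<and> B q < m (X i)) \<and> X i < X (Suc i) \<and>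
    (\<forall>r\<in>P. B r < m (X i) \<longrightarrow> X (Suc i) \<le> A r)"
proof -
  obtain p0 where "p0 \<in> P" "B p0 = m (X i)" using m_attained[of p "X i"] assms by auto
  then have "m (X i) > 0" using B_pos[of p0] by simp
  then obtain p' where p': "p' \<in> P" "B p' < m (X i)" using B_small by blast
  obtain q where q: "q \<in> P" "B q < m (X i)" "\<And>r. r \<in> P \<Longrightarrow> B r < m (X i) \<Longrightarrow> A q \<le> A r"
    using minimal_point[of p' "\<lambda>q. B q < m (X i)" A "A p'" "m (X i)"] p'
    by (metis less_imp_le)
  have gt: "X i < A q" using m_le[OF q(1), of "X i"] q(2) by linarith
  have "X (Suc i) = A q" unfolding X_Suc
  proof (rule cInf_eq_minimum)
    show "A q \<in> {t. X i < t \<and> m t < m (X i)}" using gt m_le[OF q(1) order.refl] q(2) by auto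
  next
    fix t assume "t \<in> {t. X i < t \<and> m t < m (X i)}"
    then have t: "X i < t" "m t < m (X i)" by auto
    obtain r where "r \<in> P" "A r \<le> t" "B r = m t"
      using m_attained[of p t] assms t by auto
    then show "A q \<le> t" using q(3)[of r] t by simp
  qed
  then show ?thesis using q gt by auto
qed

lemma X_in_image: "\<exists>p\<in>P. A p = X i"
proof (induction i)
  case 0
  then show ?case using X_0_least by blast
next
  case (Suc i)
  then show ?case using X_Suc_least by blast
qed

lemma X_less_Suc: "X i < X (Suc i)"
  using X_in_image[of i] X_Suc_least by blast

lemma X_Suc_le: "r \<in> P \<Longrightarrow> B r < m (X i) \<Longrightarrow> X (Suc i) \<le> A r"
  using X_in_image[of i] X_Suc_least by blast

lemma m_X_Suc_less: "m (X (Suc i)) < m (X i)"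
proof -
  obtain q where "q \<in> P" "A q = X (Suc i)" "B q < m (X i)"
    using X_in_image[of i] X_Suc_least by blast
  then show ?thesis using m_le[of q "X (Suc i)"] by simp
qed

text \<open>A point that realises the minimum up to \<open>X i\<close> cannot lie further left: it
  also beats the previous minimum, so the jump would have come earlier.\<close>

lemma best_point:
  obtains p where "p \<in> P" "A p = X i" "B p = m (X i)"
proof -
  obtain p' where "p' \<in> P" "A p' = X i" using X_in_image by blast
  then obtain p where p: "p \<in> P" "A p \<le> X i" "B p = m (X i)"
    using m_attained[of p' "X i"] by auto
  have "X i \<le> A p"
  proof (cases i)
    case 0
    then show ?thesis using X_0_least p(1) by blast
  next
    case (Suc l)
    then show ?thesis using X_Suc_le[OF p(1), of l] p(3) m_X_Suc_less[of l] by simp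
  qed
  then show ?thesis using that p by auto
qed

section \<open>Positivity, monotonicity and limits of the two sequences\<close>

lemma X_pos: "0 < X i"
  using X_in_image[of i] A_pos by force

lemma m_X_pos: "0 < m (X i)"
proof -
  obtain p where "p \<in> P" "B p = m (X i)" using best_point[of i] by blast
  then show ?thesis using B_pos[of p] by simp
qed

lemma strict_mono_X: "strict_mono X"
  by (simp add: strict_mono_Suc_iff X_less_Suc)

lemma m_X_antimono: "i \<le> j \<Longrightarrow> m (X j) \<le> m (X i)"
  by (rule lift_Suc_antimono_le[of "\<lambda>i. m (X i)"]) (simp_all add: m_X_Suc_less less_imp_le)

lemma X_unbounded: "\<exists>i. a < X i"
proof (rule ccontr)
  assume "\<nexists>i. a < X i"
  then have "X i \<le> a" for i by (simp add: not_less)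
  \<comment> \<open>Best points with bounded \<open>A\<close> would all lie in one rectangle, as
    their \<open>B\<close> is at most \<open>m (X 0)\<close>.\<close>
  have "range X \<subseteq> A ` {p \<in> P. A p \<le> a \<and> B p \<le> m (X 0)}"
  proof
    fix t assume "t \<in> range X"
    then obtain i where t: "t = X i" by auto
    obtain p where "p \<in> P" "A p = X i" "B p = m (X i)" by (rule best_point)
    then show "t \<in> A ` {p \<in> P. A p \<le> a \<and> B p \<le> m (X 0)}"
      using \<open>X i \<le> a\<close> m_X_antimono[of 0 i] t by (intro image_eqI[of _ _ p]) auto
  qed
  then have "finite (range X)" using finite_below finite_surj by blast
  then show False using strict_mono_X range_inj_infinite strict_mono_imp_inj_on by blast
qed

lemma m_X_small:
  assumes "\<epsilon> > 0"
  shows "\<exists>i. m (X i) < \<epsilon>"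
proof -
  obtain p where "p \<in> P" "B p < \<epsilon>" using B_small assms by blast
  moreover obtain i where "A p < X i" using X_unbounded by blast
  ultimately show ?thesis using m_le[of p "X i"] by (intro exI[of _ i]) auto
qed

text \<open>Between \<open>X i\<close> and \<open>X (Suc i)\<close> no point beats
  \<open>m (X i)\<close>, so the best point at \<open>X (Suc i)\<close> is a descent for all of
  them. Conversely, a descent from the best point at \<open>X i\<close> cannot end before
  \<open>X (Suc i)\<close>.\<close>

lemma bounded_X_ratio_iff:
  "(\<exists>C. \<forall>i. X (Suc i) / X i \<le> C) \<longleftrightarrow> descends P A B B"
proof
  assume "\<exists>C. \<forall>i. X (Suc i) / X i \<le> C"
  then obtain C where "\<And>i. X (Suc i) / X i \<le> C" by blast
  then have C: "X (Suc i) \<le> C * X i" for i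
    using X_pos[of i] by (simp add: divide_le_eq)
  have "0 \<le> C" using C[of 0] X_pos[of 0] X_pos[of 1]
    by (smt (verit) mult_nonpos_nonneg One_nat_def)
  have "\<exists>q\<in>P. A q \<le> C * A p \<and> B q < B p" if p: "p \<in> P" for p
  proof -
    \<comment> \<open>This gives \<open>X i \<le> A p < X (Suc i)\<close>; for \<open>i = 0\<close>
      the left inequality holds because \<open>X 0\<close> is the least value of
      \<open>A\<close>.\<close>
    define i where "i = (LEAST i. A p < X (Suc i))"
    obtain l where "A p < X l" using X_unbounded by blast
    then have "A p < X (Suc l)" using X_less_Suc[of l] by simp
    then have lt: "A p < X (Suc i)" unfolding i_def by (rule LeastI)
    have ge: "X i \<le> A p"
    proof (cases i)
      case 0
      then show ?thesis using X_0_least p by blast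
    next
      case (Suc l)
      then show ?thesis using not_less_Least[of l "\<lambda>i. A p < X (Suc i)"] by (simp add: i_def)
    qed
    obtain q where q: "q \<in> P" "A q = X (Suc i)" "B q = m (X (Suc i))" by (rule best_point)
    have "A q \<le> C * A p" using q C[of i] mult_left_mono[OF ge \<open>0 \<le> C\<close>] by simp
    moreover have "B q < B p" using q X_Suc_le[OF p, of i] lt m_X_Suc_less[of i] by linarith
    ultimately show ?thesis using q by blast
  qed
  then show "descends P A B B" unfolding descends_def by (metis zero_less_one)
next
  assume "descends P A B B"
  then obtain R \<epsilon> where "\<epsilon> > 0"
    and R: "\<And>p. p \<in> P \<Longrightarrow> B p < \<epsilon> \<Longrightarrow> \<exists>q\<in>P. A q \<le> R * A p \<and> B q < B p"
    unfolding descends_def by blast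
  obtain n where n: "m (X n) < \<epsilon>" using m_X_small \<open>\<epsilon> > 0\<close> by blast
  have "X (Suc i) / X i \<le> R" if i: "n \<le> i" for i
  proof -
    obtain p where p: "p \<in> P" "A p = X i" "B p = m (X i)" by (rule best_point)
    then obtain q where "q \<in> P" "A q \<le> R * X i" "B q < m (X i)"
      using R[of p] m_X_antimono[OF i] n by auto
    then have "X (Suc i) \<le> R * X i" using X_Suc_le[of q i] by simp
    then show ?thesis using X_pos[of i] by (simp add: divide_le_eq)
  qed
  then show "\<exists>C. \<forall>i. X (Suc i) / X i \<le> C" by (rule bounded_tail_imp_bounded)
qed

lemma bounded_remainder_ratio_iff:
  "(\<exists>C. \<forall>i. m (X i) / m (X (Suc i)) \<le> C) \<longleftrightarrow> descends P B A B"
proof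
  assume "\<exists>C. \<forall>i. m (X i) / m (X (Suc i)) \<le> C"
  then obtain C where "\<And>i. m (X i) / m (X (Suc i)) \<le> C" by blast
  then have C: "m (X i) \<le> C * m (X (Suc i))" for i
    using m_X_pos[of "Suc i"] by (simp add: divide_le_eq)
  have "0 \<le> C" using C[of 0] m_X_pos[of 0] m_X_pos[of 1]
    by (smt (verit) mult_nonpos_nonneg One_nat_def)
  have "\<exists>q\<in>P. B q \<le> C * B p \<and> A q < A p" if p: "p \<in> P" and small: "B p < m (X 0)" for p
  proof -
    \<comment> \<open>This gives \<open>m (X (Suc i)) \<le> B p < m (X i)\<close>, the case
      \<open>i = 0\<close> being the threshold \<open>m (X 0)\<close>. Hence \<open>p\<close> lies
      at or beyond \<open>X (Suc i)\<close>, and the best point at \<open>X i\<close> has smaller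
      \<open>A\<close>.\<close>
    define i where "i = (LEAST i. m (X (Suc i)) \<le> B p)"
    obtain l where "m (X l) < B p" using m_X_small B_pos[OF p] by blast
    then have "m (X (Suc l)) \<le> B p" using m_X_Suc_less[of l] by simp
    then have le: "m (X (Suc i)) \<le> B p" unfolding i_def by (rule LeastI)
    have lt: "B p < m (X i)"
    proof (cases i)
      case 0
      then show ?thesis using small by simp
    next
      case (Suc l)
      then show ?thesis using not_less_Least[of l "\<lambda>i. m (X (Suc i)) \<le> B p"] by (simp add: i_def)
    qed
    obtain q where q: "q \<in> P" "A q = X i" "B q = m (X i)" by (rule best_point)
    have "B q \<le> C * B p" using q C[of i] mult_left_mono[OF le \<open>0 \<le> C\<close>] by simp
    moreover have "A q < A p" using q X_Suc_le[OF p lt] X_less_Suc[of i] by simp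
    ultimately show ?thesis using q by blast
  qed
  then show "descends P B A B" unfolding descends_def using m_X_pos[of 0] by blast
next
  assume "descends P B A B"
  then obtain R \<epsilon> where "\<epsilon> > 0"
    and R: "\<And>p. p \<in> P \<Longrightarrow> B p < \<epsilon> \<Longrightarrow> \<exists>q\<in>P. B q \<le> R * B p \<and> A q < A p"
    unfolding descends_def by blast
  obtain n where n: "m (X n) < \<epsilon>" using m_X_small \<open>\<epsilon> > 0\<close> by blast
  have "m (X i) / m (X (Suc i)) \<le> R" if i: "n \<le> i" for i
  proof -
    obtain p where p: "p \<in> P" "A p = X (Suc i)" "B p = m (X (Suc i))" by (rule best_point)
    then obtain q where q: "q \<in> P" "B q \<le> R * m (X (Suc i))" "A q < X (Suc i)"
      using R[of p] m_X_antimono[of n "Suc i"] i n by auto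
    \<comment> \<open>A point to the left of \<open>X (Suc i)\<close> cannot have \<open>B\<close>
      below \<open>m (X i)\<close>.\<close>
    then have "m (X i) \<le> R * m (X (Suc i))" using X_Suc_le[OF q(1), of i] by linarith
    then show ?thesis using m_X_pos[of "Suc i"] by (simp add: divide_le_eq)
  qed
  then show "\<exists>C. \<forall>i. m (X i) / m (X (Suc i)) \<le> C" by (rule bounded_tail_imp_bounded)
qed

end

section \<open>Approximation vectors\<close>

lemma zero_in_integer_vectors: "0 \<in> integer_vectors"
  by (simp add: integer_vectors_def)

lemma integer_vectors_diff:
  "v \<in> integer_vectors \<Longrightarrow> w \<in> integer_vectors \<Longrightarrow> v - w \<in> integer_vectors"
  by (simp add: integer_vectors_def)

lemma norm_integer_vector_ge_1:
  assumes "v \<in> integer_vectors" "v \<noteq> 0"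
  shows "1 \<le> norm v"
proof -
  obtain i where i: "v $ i \<noteq> 0" using assms(2) by (auto simp: vec_eq_iff)
  moreover have "v $ i \<in> \<int>" using assms(1) by (simp add: integer_vectors_def)
  ultimately have "1 \<le> \<bar>v $ i\<bar>" by (rule Ints_nonzero_abs_ge1[rotated])
  then show ?thesis using component_le_norm_cart[of v i] by simp
qed

lemma finite_integer_vectors_is_norm_le:
  fixes N :: "real ^ 'k \<Rightarrow> real"
  assumes "is_norm N"
  shows "finite {v \<in> integer_vectors. N v \<le> b}"
proof -
  obtain a where a: "a > 0" "\<And>v. norm v \<le> a * N v" using norm_le_is_norm[OF assms] by blast
  define I where "I = {t::real \<in> \<int>. - (a * b) \<le> t \<and> t \<le> a * b}"
  have "finite (PiE (UNIV :: 'k set) (\<lambda>_. I))"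
    unfolding I_def by (intro finite_PiE finite_int_segment) simp
  moreover have "{v \<in> integer_vectors. N v \<le> b} \<subseteq> vec_lambda ` (PiE (UNIV :: 'k set) (\<lambda>_. I))"
  proof
    fix v :: "real ^ 'k" assume v: "v \<in> {v \<in> integer_vectors. N v \<le> b}"
    have "a * N v \<le> a * b" using a(1) v by simp
    then have "\<bar>v $ i\<bar> \<le> a * b" for i
      using component_le_norm_cart[of v i] a(2)[of v] by linarith
    then have "v $ i \<in> I" for i
      using v abs_le_iff[of "v $ i" "a * b"] by (auto simp: I_def integer_vectors_def)
    then have "vec_nth v \<in> PiE UNIV (\<lambda>_. I)" by auto
    then show "v \<in> vec_lambda ` (PiE UNIV (\<lambda>_. I))" by (intro image_eqI[of _ _ "vec_nth v"]) auto
  qed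
  ultimately show ?thesis using finite_surj by blast
qed

lemma integer_vector_near:
  fixes v :: "real ^ 'k"
  obtains y where "y \<in> integer_vectors" "norm (v - y) \<le> real CARD('k)"
proof
  define y :: "real ^ 'k" where "y = (\<chi> i. of_int \<lfloor>v $ i\<rfloor>)"
  show "y \<in> integer_vectors" by (simp add: y_def integer_vectors_def)
  have "\<bar>(v - y) $ i\<bar> \<le> 1" for i by (simp add: y_def) linarith
  then have "(\<Sum>i\<in>UNIV. \<bar>(v - y) $ i\<bar>) \<le> (\<Sum>i\<in>(UNIV :: 'k set). 1)" by (rule sum_mono)
  then show "norm (v - y) \<le> real CARD('k)" using norm_le_l1_cart[of "v - y"] by simp
qed

text \<open>Storing the error vector instead of \<open>y\<close> makes norm and remainder functions
  of one component each, and the map from \<open>(x, y)\<close> is additive, so differences stay of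
  this form.\<close>

definition approx_points :: "real ^ 'm ^ 'n \<Rightarrow> ((real ^ 'm) \<times> (real ^ 'n)) set" where
  "approx_points \<xi> =
     {(x, \<xi> *v x - y) | x y. x \<in> integer_vectors \<and> y \<in> integer_vectors \<and> x \<noteq> 0}"

lemma approx_pointsI:
  "x \<in> integer_vectors \<Longrightarrow> y \<in> integer_vectors \<Longrightarrow> x \<noteq> 0 \<Longrightarrow> (x, \<xi> *v x - y) \<in> approx_points \<xi>"
  by (auto simp: approx_points_def)

lemma approx_pointsE:
  assumes "p \<in> approx_points \<xi>"
  obtains x y where "p = (x, \<xi> *v x - y)" "x \<in> integer_vectors" "y \<in> integer_vectors" "x \<noteq> 0"
  using assms by (auto simp: approx_points_def)

lemma approx_points_diff:
  assumes "p \<in> approx_points \<xi>" "q \<in> approx_points \<xi>" "fst p \<noteq> fst q"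
  shows "p - q \<in> approx_points \<xi>"
proof -
  obtain x y x' y' where p: "p = (x, \<xi> *v x - y)" and q: "q = (x', \<xi> *v x' - y')"
    and int: "x \<in> integer_vectors" "y \<in> integer_vectors" "x' \<in> integer_vectors" "y' \<in> integer_vectors"
    using assms(1,2) by (blast elim: approx_pointsE)
  have "p - q = (x - x', \<xi> *v (x - x') - (y - y'))"
    by (simp add: p q matrix_vector_mult_diff_distrib)
  moreover have "x - x' \<noteq> 0" using assms(3) p q by simp
  ultimately show ?thesis by (simp only: approx_pointsI int integer_vectors_diff not_False_eq_True)
qed

text \<open>If the \<open>x\<close> parts agree, the difference is \<open>(0, w)\<close> with
  \<open>w\<close> a nonzero integer vector, whose norm is bounded below.\<close>

lemma approx_points_diff_small:
  fixes \<xi> :: "real ^ 'm ^ 'n"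
  assumes "is_norm N"
  obtains c where "c > 0"
    "\<And>p q. p \<in> approx_points \<xi> \<Longrightarrow> q \<in> approx_points \<xi> \<Longrightarrow> p \<noteq> q \<Longrightarrow> N (snd (p - q)) < c \<Longrightarrow>
      p - q \<in> approx_points \<xi>"
proof -
  obtain a where a: "a > 0" "\<And>v. norm v \<le> a * N v" using norm_le_is_norm[OF assms] by blast
  have "p - q \<in> approx_points \<xi>"
    if p: "p \<in> approx_points \<xi>" and q: "q \<in> approx_points \<xi>" and "p \<noteq> q"
      and small: "N (snd (p - q)) < 1 / a" for p q
  proof (rule approx_points_diff[OF p q])
    show "fst p \<noteq> fst q"
    proof
      assume eq: "fst p = fst q"
      obtain x y x' y' where pq: "p = (x, \<xi> *v x - y)" "q = (x', \<xi> *v x' - y')"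
        and int: "y \<in> integer_vectors" "y' \<in> integer_vectors"
        using p q by (blast elim: approx_pointsE)
      have snd: "snd (p - q) = y' - y" using eq pq by simp
      have "y' - y \<noteq> 0" using eq pq \<open>p \<noteq> q\<close> by auto
      then have "1 \<le> norm (y' - y)" using int by (intro norm_integer_vector_ge_1 integer_vectors_diff)
      also have "\<dots> \<le> a * N (y' - y)" by (rule a)
      finally show False using small a(1) unfolding snd by (simp add: field_simps)
    qed
  qed
  then show ?thesis using that[of "1 / a"] a(1) by simp
qed

lemma staircase_approx_points:
  fixes \<xi> :: "real ^ 'm ^ 'n"
  assumes irr: "totally_irrational \<xi>" and N1: "is_norm N1" and N2: "is_norm N2"
  shows "staircase (approx_points \<xi>) (\<lambda>p. N1 (fst p)) (\<lambda>p. N2 (snd p))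
    (min_remainder N1 N2 \<xi>) (best_norm N1 N2 \<xi>)"
proof
  let ?P = "approx_points \<xi>"
  have N1_pos: "0 < N1 v \<longleftrightarrow> v \<noteq> 0" for v
    using N1 unfolding is_norm_def by (metis order_less_le)
  have N2_pos: "0 < N2 v \<longleftrightarrow> v \<noteq> 0" for v
    using N2 unfolding is_norm_def by (metis order_less_le)
  obtain \<beta> where \<beta>: "\<beta> > 0" "\<And>v. N2 v \<le> \<beta> * norm v" using is_norm_le_norm[OF N2] by blast
  \<comment> \<open>Bounds the error of rounding any vector to an integer vector.\<close>
  define b where "b = \<beta> * real CARD('n)"
  have "b > 0" using \<beta>(1) by (simp add: b_def)
  have near: "\<exists>y\<in>integer_vectors. N2 (v - y) \<le> b" for v
  proof -
    obtain y where y: "y \<in> integer_vectors" "norm (v - y) \<le> real CARD('n)"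
      by (rule integer_vector_near)
    then have "\<beta> * norm (v - y) \<le> b" unfolding b_def using \<beta>(1) by (intro mult_left_mono) auto
    then show ?thesis using y(1) \<beta>(2)[of "v - y"] by force
  qed
  show "0 < N1 (fst p)" if "p \<in> ?P" for p
    using that by (auto simp: N1_pos elim!: approx_pointsE)
  show "0 < N2 (snd p)" if p_in: "p \<in> ?P" for p
  proof -
    obtain x y where p: "p = (x, \<xi> *v x - y)"
      and int: "x \<in> integer_vectors" "y \<in> integer_vectors" and "x \<noteq> 0"
      using p_in by (blast elim: approx_pointsE)
    then have "(x, y) \<noteq> (0, 0)" by simp
    \<comment> \<open>Positivity only says that the error vector is nonzero, so it carries over from
      the sup-norm to \<open>N2\<close>.\<close>
    then have "infnorm (\<xi> *v x - y) > 0"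
      using irr int unfolding totally_irrational_def by blast
    then show ?thesis unfolding p snd_conv N2_pos infnorm_pos_lt .
  qed
  show "finite {p \<in> ?P. N1 (fst p) \<le> a \<and> N2 (snd p) \<le> t}" for a t
  proof -
    define T where "T = (SIGMA x:{x \<in> integer_vectors. N1 x \<le> a}.
      {y \<in> integer_vectors. N2 y \<le> N2 (\<xi> *v x) + t})"
    have "finite T"
      unfolding T_def using N1 N2 by (intro finite_SigmaI finite_integer_vectors_is_norm_le)
    moreover have "{p \<in> ?P. N1 (fst p) \<le> a \<and> N2 (snd p) \<le> t} \<subseteq> (\<lambda>(x, y). (x, \<xi> *v x - y)) ` T"
    proof
      fix p assume p: "p \<in> {p \<in> ?P. N1 (fst p) \<le> a \<and> N2 (snd p) \<le> t}"
      then obtain x y where xy: "p = (x, \<xi> *v x - y)" "x \<in> integer_vectors" "y \<in> integer_vectors"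
        by (blast elim: approx_pointsE)
      have "N2 y \<le> N2 (\<xi> *v x) + N2 (\<xi> *v x - y)"
        using is_norm_diff_le[OF N2, of "\<xi> *v x" "\<xi> *v x - y"] by simp
      then have "(x, y) \<in> T" using p xy by (auto simp: T_def)
      then show "p \<in> (\<lambda>(x, y). (x, \<xi> *v x - y)) ` T" using xy(1) by force
    qed
    ultimately show ?thesis using finite_surj by blast
  qed
  show "\<exists>b. \<forall>p\<in>?P. \<exists>q\<in>?P. N1 (fst q) = N1 (fst p) \<and> N2 (snd q) \<le> b"
  proof (intro exI ballI)
    fix p assume "p \<in> ?P"
    then obtain x where x: "fst p = x" "x \<in> integer_vectors" "x \<noteq> 0"
      by (force elim: approx_pointsE)
    obtain y where "y \<in> integer_vectors" "N2 (\<xi> *v x - y) \<le> b" using near by blast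
    then show "\<exists>q\<in>?P. N1 (fst q) = N1 (fst p) \<and> N2 (snd q) \<le> b"
      using x by (intro bexI[of _ "(x, \<xi> *v x - y)"]) (auto intro: approx_pointsI)
  qed
  show "\<exists>p\<in>?P. N2 (snd p) < \<epsilon>" if "\<epsilon> > 0" for \<epsilon>
  proof -
    have "\<epsilon> / (2 * b) > 0" using \<open>\<epsilon> > 0\<close> \<open>b > 0\<close> by simp
    obtain K where K: "\<And>s (v :: nat \<Rightarrow> _). s > 0 \<Longrightarrow> (\<And>j. j \<le> K \<Longrightarrow> N2 (v j) \<le> s) \<Longrightarrow>
        \<exists>i j. i < j \<and> j \<le> K \<and> N2 (v i - v j) \<le> (\<epsilon> / (2 * b)) * s"
      using is_norm_pigeonhole[OF N2 \<open>\<epsilon> / (2 * b) > 0\<close>] by blast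
    \<comment> \<open>Dirichlet's argument: the error vectors of these distinct \<open>x j\<close>
      are bounded by \<open>b\<close>, so two are within \<open>\<epsilon> / 2\<close> of each
      other, and their difference has nonzero \<open>x\<close>. The shift by one makes
      \<open>x 0\<close> nonzero.\<close>
    define x :: "nat \<Rightarrow> real ^ 'm" where "x j = (\<chi> l. real (Suc j))" for j
    have x: "x j \<in> integer_vectors" "x j \<noteq> 0" for j
      by (auto simp: x_def integer_vectors_def vec_eq_iff)
    have "\<forall>j. \<exists>y. y \<in> integer_vectors \<and> N2 (\<xi> *v x j - y) \<le> b" using near by blast
    then obtain y where y: "\<And>j. y j \<in> integer_vectors" "\<And>j. N2 (\<xi> *v x j - y j) \<le> b"
      by metis
    define v where "v j = \<xi> *v x j - y j" for j
    have "N2 (v j) \<le> b" for j unfolding v_def by (rule y)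
    then obtain i j where ij: "i < j" "N2 (v i - v j) \<le> (\<epsilon> / (2 * b)) * b"
      using K[of b v] \<open>b > 0\<close> by blast
    have P: "(x j, v j) \<in> ?P" for j
      unfolding v_def using x y by (intro approx_pointsI)
    have "x i \<noteq> x j" using ij(1) by (auto simp: x_def vec_eq_iff)
    then have "(x i, v i) - (x j, v j) \<in> ?P" using approx_points_diff[OF P P] by simp
    moreover have "N2 (v i - v j) < \<epsilon>" using ij(2) \<open>b > 0\<close> \<open>\<epsilon> > 0\<close> by simp
    ultimately show ?thesis by force
  qed
  show "min_remainder N1 N2 \<xi> t = Inf ((\<lambda>p. N2 (snd p)) ` {p \<in> ?P. N1 (fst p) \<le> t})" for t
    unfolding min_remainder_def
    by (rule arg_cong[of _ _ Inf]) (force simp: approx_points_def N1_pos)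
  show "best_norm N1 N2 \<xi> 0 = Inf ((\<lambda>p. N1 (fst p)) ` ?P)"
    unfolding best_norm.simps
    by (rule arg_cong[of _ _ Inf])
      (use zero_in_integer_vectors in \<open>force simp: approx_points_def N1_pos\<close>)
qed simp

section \<open>Change of norms for approximation vectors\<close>

lemma descends_approx_points_transfer:
  fixes \<xi> :: "real ^ 'm ^ 'n"
  assumes irr: "totally_irrational \<xi>"
    and N: "is_norm N1" "is_norm N2" and M: "is_norm M1" "is_norm M2"
  shows "descends (approx_points \<xi>) (\<lambda>p. N1 (fst p)) (\<lambda>p. N2 (snd p)) (\<lambda>p. N2 (snd p)) \<Longrightarrow>
      descends (approx_points \<xi>) (\<lambda>p. M1 (fst p)) (\<lambda>p. M2 (snd p)) (\<lambda>p. M2 (snd p))"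
    and "descends (approx_points \<xi>) (\<lambda>p. N2 (snd p)) (\<lambda>p. N1 (fst p)) (\<lambda>p. N2 (snd p)) \<Longrightarrow>
      descends (approx_points \<xi>) (\<lambda>p. M2 (snd p)) (\<lambda>p. M1 (fst p)) (\<lambda>p. M2 (snd p))"
proof -
  interpret M: staircase "approx_points \<xi>" "\<lambda>p. M1 (fst p)" "\<lambda>p. M2 (snd p)"
    "min_remainder M1 M2 \<xi>" "best_norm M1 M2 \<xi>"
    using irr M by (rule staircase_approx_points)
  obtain k1 where k1: "k1 > 0" "\<And>v. N1 v \<le> k1 * M1 v" using is_norm_equivalent[OF N(1) M(1)] by blast
  obtain k2 where k2: "k2 > 0" "\<And>v. M1 v \<le> k2 * N1 v" using is_norm_equivalent[OF M(1) N(1)] by blast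
  obtain k3 where k3: "k3 > 0" "\<And>v. N2 v \<le> k3 * M2 v" using is_norm_equivalent[OF N(2) M(2)] by blast
  obtain k4 where k4: "k4 > 0" "\<And>v. M2 v \<le> k4 * N2 v" using is_norm_equivalent[OF M(2) N(2)] by blast
  define k where "k = max (max k1 k2) (max k3 k4)"
  have "k > 0" using k1(1) by (simp add: k_def)
  have nonneg: "0 \<le> N1 v" "0 \<le> M1 v" "0 \<le> N2 w" "0 \<le> M2 w" for v w
    using N M unfolding is_norm_def by auto
  have le: "k1 \<le> k" "k2 \<le> k" "k3 \<le> k" "k4 \<le> k" by (simp_all add: k_def)
  note k = order.trans[OF k1(2) mult_right_mono[OF le(1) nonneg(2)]]
    order.trans[OF k2(2) mult_right_mono[OF le(2) nonneg(1)]]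
    order.trans[OF k3(2) mult_right_mono[OF le(3) nonneg(4)]]
    order.trans[OF k4(2) mult_right_mono[OF le(4) nonneg(3)]]
  have pigeonhole1: "\<exists>K. \<forall>s>0. \<forall>v :: nat \<Rightarrow> _. (\<forall>j\<le>K. N1 (fst (v j)) \<le> s) \<longrightarrow>
      (\<exists>i j. i < j \<and> j \<le> K \<and> N1 (fst (v i - v j)) \<le> \<eta> * s)" if "\<eta> > 0" for \<eta>
  proof -
    obtain K where K: "\<And>s (v :: nat \<Rightarrow> _). s > 0 \<Longrightarrow> (\<And>j. j \<le> K \<Longrightarrow> N1 (v j) \<le> s) \<Longrightarrow>
        \<exists>i j. i < j \<and> j \<le> K \<and> N1 (v i - v j) \<le> \<eta> * s"
      using is_norm_pigeonhole[OF N(1) \<open>\<eta> > 0\<close>] by blast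
    have "\<exists>i j. i < j \<and> j \<le> K \<and> N1 (fst (v i - v j)) \<le> \<eta> * s"
      if "s > 0" "\<forall>j\<le>K. N1 (fst (v j)) \<le> s" for s and v :: "nat \<Rightarrow> _"
      using K[of s "\<lambda>j. fst (v j)"] that by simp
    then show ?thesis by blast
  qed
  have pigeonhole2: "\<exists>K. \<forall>s>0. \<forall>v :: nat \<Rightarrow> _. (\<forall>j\<le>K. N2 (snd (v j)) \<le> s) \<longrightarrow>
      (\<exists>i j. i < j \<and> j \<le> K \<and> N2 (snd (v i - v j)) \<le> \<eta> * s)" if "\<eta> > 0" for \<eta>
  proof -
    obtain K where K: "\<And>s (v :: nat \<Rightarrow> _). s > 0 \<Longrightarrow> (\<And>j. j \<le> K \<Longrightarrow> N2 (v j) \<le> s) \<Longrightarrow>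
        \<exists>i j. i < j \<and> j \<le> K \<and> N2 (v i - v j) \<le> \<eta> * s"
      using is_norm_pigeonhole[OF N(2) \<open>\<eta> > 0\<close>] by blast
    have "\<exists>i j. i < j \<and> j \<le> K \<and> N2 (snd (v i - v j)) \<le> \<eta> * s"
      if "s > 0" "\<forall>j\<le>K. N2 (snd (v j)) \<le> s" for s and v :: "nat \<Rightarrow> _"
      using K[of s "\<lambda>j. snd (v j)"] that by simp
    then show ?thesis by blast
  qed
  have diff: "N1 (fst (p - q)) \<le> N1 (fst p) + N1 (fst q)"
    "N2 (snd (p - q)) \<le> N2 (snd p) + N2 (snd q)" for p q
    using N by (simp_all add: is_norm_diff_le)
  obtain c where c: "c > 0"
    "\<And>p q. p \<in> approx_points \<xi> \<Longrightarrow> q \<in> approx_points \<xi> \<Longrightarrow> p \<noteq> q \<Longrightarrow> N2 (snd (p - q)) < c \<Longrightarrow>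
      p - q \<in> approx_points \<xi>"
    using approx_points_diff_small[OF N(2)] by blast
  \<comment> \<open>The remainder decreases here, so \<open>S = G\<close> and the pigeonhole is
    applied to error vectors.\<close>
  show "descends (approx_points \<xi>) (\<lambda>p. M1 (fst p)) (\<lambda>p. M2 (snd p)) (\<lambda>p. M2 (snd p))"
    if "descends (approx_points \<xi>) (\<lambda>p. N1 (fst p)) (\<lambda>p. N2 (snd p)) (\<lambda>p. N2 (snd p))"
    by (rule descends_transfer[OF that _ nonneg(1) diff(1) nonneg(3) pigeonhole2 c \<open>k > 0\<close>])
      (simp_all add: k M.B_pos)
  \<comment> \<open>Now \<open>S = F\<close>: the norm of \<open>x\<close> decreases and the
    pigeonhole is applied to the \<open>x\<close> parts.\<close>
  show "descends (approx_points \<xi>) (\<lambda>p. M2 (snd p)) (\<lambda>p. M1 (fst p)) (\<lambda>p. M2 (snd p))"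
    if "descends (approx_points \<xi>) (\<lambda>p. N2 (snd p)) (\<lambda>p. N1 (fst p)) (\<lambda>p. N2 (snd p))"
    by (rule descends_transfer[OF that _ nonneg(3) diff(2) nonneg(1) pigeonhole1 c \<open>k > 0\<close>])
      (simp_all add: k M.A_pos)
qed

section \<open>Finite suprema and the two equivalences\<close>

lemma SUP_ereal_less_infinity_iff:
  fixes u :: "nat \<Rightarrow> real"
  shows "(SUP i. ereal (u i)) < \<infinity> \<longleftrightarrow> (\<exists>C. \<forall>i. u i \<le> C)"
proof
  assume "(SUP i. ereal (u i)) < \<infinity>"
  then obtain C where "(SUP i. ereal (u i)) < ereal C"
    using less_PInf_Ex_of_nat[of "SUP i. ereal (u i)"] by auto
  then have "u i < C" for i
    using le_less_trans[OF SUP_upper[of i UNIV "\<lambda>i. ereal (u i)"]] by fastforce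
  then show "\<exists>C. \<forall>i. u i \<le> C" using less_imp_le by blast
next
  assume "\<exists>C. \<forall>i. u i \<le> C"
  then obtain C where "\<And>i. u i \<le> C" by blast
  then have "(SUP i. ereal (u i)) \<le> ereal C" by (intro SUP_least) simp
  then show "(SUP i. ereal (u i)) < \<infinity>" using le_less_trans by fastforce
qed

theorem theorem1:
  fixes \<xi> :: "real ^ 'm ^ 'n"
    and N1 :: "real ^ 'm \<Rightarrow> real"
    and N2 :: "real ^ 'n \<Rightarrow> real"
    and X L X' L' :: "nat \<Rightarrow> real"
  defines "X \<equiv> best_norm infnorm infnorm \<xi>"
    and "L \<equiv> best_remainder infnorm infnorm \<xi>"
    and "X' \<equiv> best_norm N1 N2 \<xi>"
    and "L' \<equiv> best_remainder N1 N2 \<xi>"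
  assumes "totally_irrational \<xi>"
    and "is_norm N1"
    and "is_norm N2"
  shows "((SUP i. ereal (X (Suc i) / X i)) < \<infinity> \<longleftrightarrow>
          (SUP i. ereal (X' (Suc i) / X' i)) < \<infinity>) \<and>
         ((SUP i. ereal (L i / L (Suc i))) < \<infinity> \<longleftrightarrow>
          (SUP i. ereal (L' i / L' (Suc i))) < \<infinity>)"
proof -
  note irr = \<open>totally_irrational \<xi>\<close> and N = \<open>is_norm N1\<close> \<open>is_norm N2\<close>
  note inf = is_norm_infnorm[where 'a = "real ^ 'm"] is_norm_infnorm[where 'a = "real ^ 'n"]
  note sup_staircase = staircase_approx_points[OF irr inf]
  note N_staircase = staircase_approx_points[OF irr N]
  note to_N = descends_approx_points_transfer[OF irr inf N]
  note to_sup = descends_approx_points_transfer[OF irr N inf]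
  show ?thesis
    unfolding SUP_ereal_less_infinity_iff X_def L_def X'_def L'_def best_remainder_def
      staircase.bounded_X_ratio_iff[OF sup_staircase]
      staircase.bounded_X_ratio_iff[OF N_staircase]
      staircase.bounded_remainder_ratio_iff[OF sup_staircase]
      staircase.bounded_remainder_ratio_iff[OF N_staircase]
    using to_N to_sup by blast
qed

end
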